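(* Let $k\ge 3$ and let $G$ be a mixed $k$-melon graph whose set of paths $\mathcal{P}=\mathcal{P}_{even}\cup\mathcal{P}_{odd}$ satisfies $|\mathcal{P}_{even}|=1$, say $\mathcal{P}_{even}=\{P_e\}$ with vertices $u_0=t,u_1,\dots,u_{2m}=s$ ($m\ge1$). For each odd path $P_o\in\mathcal{P}_{odd}$ write its vertices as $v_0=t,v_1,\dots,v_{2m_o+1}=s$. Define: (i) $U_s$ as the union of $\{s\}\cup\{u_{2j+1}:0\le j\le m-1\}$ and, for every $P_o\in\mathcal{P}_{odd}$, the set $\{v_{2i+1}:0\le i\le m_o\}$ (so $t\notin U_s$); (ii) $U_t$ as the union of $\{t\}\cup\{u_{2j+1}:0\le j\le m-1\}$ and, for every $P_o\in\mathcal{P}_{odd}$, the set $\{v_{2i}:0\le i\le m_o\}$ (so $s\notin U_t$); (iii) for $\mathcal{S}_o\subseteq\mathcal{P}_{odd}$, $U_{\mathcal{S}_o}$ as the vertex set such that $P_e$ is internal, every path of $\mathcal{S}_o$ is an $s$-path and every path of $\mathcal{P}_{odd}\setminus\mathcal{S}_o$ is a $t$-path, all with respect to $U_{\mathcal{S}_o}$. Then $\mathrm{evc}(G)=\mathrm{vc}(G)$, and $\mathcal{U}=\{U_s,U_t\}\cup\{U_{\mathcal{S}_o} : \emptyset\ne\mathcal{S}_o\subsetneq\mathcal{P}_{odd}\}$ is a minimum eternal vertex cover class of $G$.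
   Context: For $k\ge1$, a $k$-melon graph is the union of a set $\mathcal{P}$ of $k$ pairwise internally vertex-disjoint paths, each of length at least $1$, with the same two distinct endpoints $s$ and $t$. $\mathcal{P}_{even}$ and $\mathcal{P}_{odd}$ are the paths of even and odd length; $G$ is mixed if both are nonempty. For an even path $P$ with vertices $v_0,\dots,v_{2m}$, $\{v_0,v_{2m}\}=\{s,t\}$, and a vertex set $U$: $P$ is internal w.r.t. $U$ if $U\cap V(P)=\{v_{2j}:0\le j\le m\}$. For an odd path $P_o$ with vertices $v_0=t,\dots,v_{2m+1}=s$: $P_o$ is an $s$-path w.r.t. $U$ if $(U\cap V(P_o))\setminus\{t\}=\{v_{2i+1}:0\le i\le m\}$, a $t$-path if $(U\cap V(P_o))\setminus\{s\}=\{v_{2i}:0\le i\le m\}$. $\mathrm{vc}(G)$ is the vertex cover number. For a vertex cover $U$ of $G=(V,E)$ and an edge $e=vw$, a defense of $U$ against $e$ is a one-to-one map $\phi:U\to V$ with $\phi(u)\in N[u]$ (closed neighborhood) for all $u\in U$ and $\phi(v)=w$ (with $v\in U$) or $\phi(w)=v$ (with $w\in U$). An eternal vertex cover class is a family $\mathcal{U}$ of vertex covers of equal cardinality (its size) such that for every $U\in\mathcal{U}$ and every edge $e$ there is a defense $\phi$ of $U$ against $e$ with $\phi(U)\in\mathcal{U}$; $\mathrm{evc}(G)$ is the minimum size of such a class, and a class of that size is minimum. *)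

theory Defs
  imports Main
begin

(* An undirected graph is a pair of a vertex set and a set of edges {v, w}. *)

type_synonym 'a ugraph = "'a set \<times> 'a set set"

abbreviation verts :: "'a ugraph \<Rightarrow> 'a set" where "verts \<equiv> fst"

abbreviation edges :: "'a ugraph \<Rightarrow> 'a set set" where "edges \<equiv> snd"

definition finite_simple_graph :: "'a ugraph \<Rightarrow> bool" where
  "finite_simple_graph G \<longleftrightarrow>
     finite (verts G) \<and>
     (\<forall>e \<in> edges G. \<exists>v w. v \<in> verts G \<and> w \<in> verts G \<and> v \<noteq> w \<and> e = {v, w})"

definition closed_nbhd :: "'a ugraph \<Rightarrow> 'a \<Rightarrow> 'a set" where
  "closed_nbhd G u = insert u {w. {u, w} \<in> edges G}"

definition vertex_cover :: "'a ugraph \<Rightarrow> 'a set \<Rightarrow> bool" where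
  "vertex_cover G U \<longleftrightarrow> U \<subseteq> verts G \<and> (\<forall>e \<in> edges G. e \<inter> U \<noteq> {})"

definition vc :: "'a ugraph \<Rightarrow> nat" where
  "vc G = (LEAST n. \<exists>U. vertex_cover G U \<and> card U = n)"

(* phi is only relevant on U. *)

definition defense :: "'a ugraph \<Rightarrow> 'a set \<Rightarrow> 'a \<Rightarrow> 'a \<Rightarrow> ('a \<Rightarrow> 'a) \<Rightarrow> bool" where
  "defense G U v w \<phi> \<longleftrightarrow>
     inj_on \<phi> U \<and>
     (\<forall>u \<in> U. \<phi> u \<in> closed_nbhd G u) \<and>
     ((v \<in> U \<and> \<phi> v = w) \<or> (w \<in> U \<and> \<phi> w = v))"

(* Classes are nonempty: the empty family would satisfy the remaining clauses for every n. *)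

definition evc_class :: "'a ugraph \<Rightarrow> nat \<Rightarrow> 'a set set \<Rightarrow> bool" where
  "evc_class G n \<U> \<longleftrightarrow>
     \<U> \<noteq> {} \<and>
     (\<forall>U \<in> \<U>. vertex_cover G U \<and> card U = n) \<and>
     (\<forall>U \<in> \<U>. \<forall>v w. {v, w} \<in> edges G \<longrightarrow> (\<exists>\<phi>. defense G U v w \<phi> \<and> \<phi> ` U \<in> \<U>))"

definition evc :: "'a ugraph \<Rightarrow> nat" where
  "evc G = (LEAST n. \<exists>\<U>. evc_class G n \<U>)"

definition minimum_evc_class :: "'a ugraph \<Rightarrow> 'a set set \<Rightarrow> bool" where
  "minimum_evc_class G \<U> \<longleftrightarrow> evc_class G (evc G) \<U>"

(* A path is given by the list v_0, ..., v_l of its vertices; its length l counts edges. *)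

definition path_edges :: "'a list \<Rightarrow> 'a set set" where
  "path_edges p = {{p ! i, p ! Suc i} | i. Suc i < length p}"

definition path_length :: "'a list \<Rightarrow> nat" where
  "path_length p = length p - 1"

definition is_path :: "'a \<Rightarrow> 'a \<Rightarrow> 'a list \<Rightarrow> bool" where
  "is_path x y p \<longleftrightarrow> p \<noteq> [] \<and> distinct p \<and> hd p = x \<and> last p = y"

(* All paths of a melon graph are listed from t to s; as s and t differ, each
   path between them has exactly one such list. *)

definition melon_graph :: "nat \<Rightarrow> 'a ugraph \<Rightarrow> 'a \<Rightarrow> 'a \<Rightarrow> 'a list set \<Rightarrow> bool" where
  "melon_graph k G s t \<P> \<longleftrightarrow>
     k \<ge> 1 \<and> s \<noteq> t \<and> finite \<P> \<and> card \<P> = k \<and>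
     (\<forall>p \<in> \<P>. is_path t s p \<and> path_length p \<ge> 1) \<and>
     (\<forall>p \<in> \<P>. \<forall>q \<in> \<P>. p \<noteq> q \<longrightarrow> (set p - {s, t}) \<inter> (set q - {s, t}) = {}) \<and>
     verts G = (\<Union>p \<in> \<P>. set p) \<and>
     edges G = (\<Union>p \<in> \<P>. path_edges p)"

definition even_paths :: "'a list set \<Rightarrow> 'a list set" where
  "even_paths \<P> = {p \<in> \<P>. even (path_length p)}"

definition odd_paths :: "'a list set \<Rightarrow> 'a list set" where
  "odd_paths \<P> = {p \<in> \<P>. odd (path_length p)}"

definition mixed :: "'a list set \<Rightarrow> bool" where
  "mixed \<P> \<longleftrightarrow> even_paths \<P> \<noteq> {} \<and> odd_paths \<P> \<noteq> {}"

(* The number m of a path of length 2m or 2m + 1. *)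

definition half :: "'a list \<Rightarrow> nat" where
  "half p = path_length p div 2"

definition internal_path :: "'a set \<Rightarrow> 'a list \<Rightarrow> bool" where
  "internal_path U p \<longleftrightarrow> U \<inter> set p = {p ! (2 * j) | j. j \<le> half p}"

definition s_path :: "'a \<Rightarrow> 'a set \<Rightarrow> 'a list \<Rightarrow> bool" where
  "s_path t U p \<longleftrightarrow> (U \<inter> set p) - {t} = {p ! (2 * i + 1) | i. i \<le> half p}"

definition t_path :: "'a \<Rightarrow> 'a set \<Rightarrow> 'a list \<Rightarrow> bool" where
  "t_path s U p \<longleftrightarrow> (U \<inter> set p) - {s} = {p ! (2 * i) | i. i \<le> half p}"

definition U_s :: "'a \<Rightarrow> 'a list \<Rightarrow> 'a list set \<Rightarrow> 'a set" where
  "U_s s P\<^sub>e \<P> =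
     {s} \<union> {P\<^sub>e ! (2 * j + 1) | j. j < half P\<^sub>e} \<union>
     (\<Union>p \<in> odd_paths \<P>. {p ! (2 * i + 1) | i. i \<le> half p})"

definition U_t :: "'a \<Rightarrow> 'a list \<Rightarrow> 'a list set \<Rightarrow> 'a set" where
  "U_t t P\<^sub>e \<P> =
     {t} \<union> {P\<^sub>e ! (2 * j + 1) | j. j < half P\<^sub>e} \<union>
     (\<Union>p \<in> odd_paths \<P>. {p ! (2 * i) | i. i \<le> half p})"

definition is_U_odd ::
  "'a ugraph \<Rightarrow> 'a \<Rightarrow> 'a \<Rightarrow> 'a list \<Rightarrow> 'a list set \<Rightarrow> 'a list set \<Rightarrow> 'a set \<Rightarrow> bool" where
  "is_U_odd G s t P\<^sub>e \<P> \<S> U \<longleftrightarrow>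
     U \<subseteq> verts G \<and> internal_path U P\<^sub>e \<and>
     (\<forall>p \<in> \<S>. s_path t U p) \<and>
     (\<forall>p \<in> odd_paths \<P> - \<S>. t_path s U p)"

definition U_odd ::
  "'a ugraph \<Rightarrow> 'a \<Rightarrow> 'a \<Rightarrow> 'a list \<Rightarrow> 'a list set \<Rightarrow> 'a list set \<Rightarrow> 'a set" where
  "U_odd G s t P\<^sub>e \<P> \<S> = (THE U. is_U_odd G s t P\<^sub>e \<P> \<S> U)"

lemma melon_graph_finite_simple:
  assumes "melon_graph k G s t \<P>"
  shows "finite_simple_graph G"
proof -
  have fin: "finite (verts G)" using assms by (auto simp: melon_graph_def)
  have "\<exists>v w. v \<in> verts G \<and> w \<in> verts G \<and> v \<noteq> w \<and> e = {v, w}" if e: "e \<in> edges G" for e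
  proof -
    obtain p i where p: "p \<in> \<P>" "Suc i < length p" "e = {p ! i, p ! Suc i}"
      using e assms by (auto simp: melon_graph_def path_edges_def)
    have "distinct p" using p assms by (auto simp: melon_graph_def is_path_def)
    then have "p ! i \<noteq> p ! Suc i" using p by (simp add: nth_eq_iff_index_eq)
    moreover have "p ! i \<in> verts G" "p ! Suc i \<in> verts G"
      using p assms by (auto simp: melon_graph_def intro!: bexI[of _ p])
    ultimately show ?thesis using p(3) by blast
  qed
  with fin show ?thesis by (simp add: finite_simple_graph_def)
qed

lemma U_odd_unique_existence:
  assumes mel: "melon_graph k G s t \<P>" and ev: "even_paths \<P> = {P\<^sub>e}"
    and S: "\<S> \<subseteq> odd_paths \<P>"
  shows "\<exists>!U. is_U_odd G s t P\<^sub>e \<P> \<S> U"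
proof -
  define ev_set where "ev_set p = {p ! (2 * j) | j. j \<le> half p}" for p :: "'a list"
  define od_set where "od_set p = {p ! (2 * j + 1) | j. j \<le> half p}" for p :: "'a list"
  define A where "A p = (if p \<in> \<S> then od_set p else ev_set p)" for p
  define W where "W = (\<Union>p \<in> \<P>. A p)"
  have st: "s \<noteq> t" using mel by (simp add: melon_graph_def)
  have V: "verts G = (\<Union>p \<in> \<P>. set p)" using mel by (simp add: melon_graph_def)
  have P: "\<P> = insert P\<^sub>e (odd_paths \<P>)" using ev by (auto simp: even_paths_def odd_paths_def)
  have PeP: "P\<^sub>e \<in> \<P>" "even (path_length P\<^sub>e)" "P\<^sub>e \<notin> \<S>"
    using ev S by (auto simp: even_paths_def odd_paths_def)
  have ends: "p ! 0 = t" "p ! path_length p = s" "distinct p" "path_length p < length p"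
    if "p \<in> \<P>" for p
    using that mel
    by (auto simp: melon_graph_def is_path_def path_length_def hd_conv_nth last_conv_nth)
  have disj: "x = s \<or> x = t" if "p \<in> \<P>" "q \<in> \<P>" "p \<noteq> q" "x \<in> set p" "x \<in> set q" for p q x
    using that mel by (auto simp: melon_graph_def)
  have oddp: "p \<in> \<P>" "path_length p = 2 * half p + 1" if "p \<in> odd_paths \<P>" for p
    using that by (auto simp: odd_paths_def half_def)
  have evl: "path_length P\<^sub>e = 2 * half P\<^sub>e" using PeP by (auto simp: half_def)
  have od: "od_set p \<subseteq> set p" "s \<in> od_set p" "t \<notin> od_set p" if p: "p \<in> odd_paths \<P>" for p
  proof -
    note e = ends[OF oddp(1)[OF p]] and l = oddp(2)[OF p]
    show "od_set p \<subseteq> set p" using e l by (auto simp: od_set_def)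
    show "s \<in> od_set p" unfolding od_set_def using e l by force
    have "p ! (2 * i + 1) \<noteq> p ! 0" if "i \<le> half p" for i
      using e l that by (subst nth_eq_iff_index_eq) auto
    then show "t \<notin> od_set p" unfolding od_set_def e(1) by blast
  qed
  have evn: "ev_set p \<subseteq> set p" "t \<in> ev_set p" "s \<notin> ev_set p" if p: "p \<in> odd_paths \<P>" for p
  proof -
    note e = ends[OF oddp(1)[OF p]] and l = oddp(2)[OF p]
    show "ev_set p \<subseteq> set p" using e l by (auto simp: ev_set_def)
    show "t \<in> ev_set p" unfolding ev_set_def using e l by force
    have "p ! (2 * i) \<noteq> p ! path_length p" if "i \<le> half p" for i
      using e l that by (subst nth_eq_iff_index_eq) auto
    then show "s \<notin> ev_set p" unfolding ev_set_def e(2) by blast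
  qed
  have Pe: "ev_set P\<^sub>e \<subseteq> set P\<^sub>e" "t \<in> ev_set P\<^sub>e" "s \<in> ev_set P\<^sub>e"
  proof -
    note e = ends[OF PeP(1)]
    show "ev_set P\<^sub>e \<subseteq> set P\<^sub>e" using e evl by (auto simp: ev_set_def)
    show "t \<in> ev_set P\<^sub>e" unfolding ev_set_def using e by force
    show "s \<in> ev_set P\<^sub>e" unfolding ev_set_def using e evl by force
  qed
  have Asub: "A p \<subseteq> set p" if "p \<in> \<P>" for p
  proof (cases "p = P\<^sub>e")
    case True
    then show ?thesis using Pe PeP by (simp add: A_def)
  next
    case False
    then have "p \<in> odd_paths \<P>" using that P by blast
    then show ?thesis using od evn by (simp add: A_def)
  qed
  have APe: "A P\<^sub>e = ev_set P\<^sub>e" using PeP by (simp add: A_def)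
  have W1: "A p \<subseteq> W \<inter> set p" "W \<inter> set p \<subseteq> A p \<union> {s, t}" if "p \<in> \<P>" for p
    using that Asub disj unfolding W_def by blast+
  have exi: "is_U_odd G s t P\<^sub>e \<P> \<S> W"
    unfolding is_U_odd_def
  proof (intro conjI ballI)
    show "W \<subseteq> verts G" using Asub by (auto simp: W_def V)
    show "internal_path W P\<^sub>e"
      unfolding internal_path_def ev_set_def[symmetric] using W1[OF PeP(1)] APe Pe by auto
    fix p
    show "s_path t W p" if p: "p \<in> \<S>"
    proof -
      have po: "p \<in> odd_paths \<P>" and "A p = od_set p" using p S by (auto simp: A_def)
      then show ?thesis
        unfolding s_path_def od_set_def[symmetric] using W1[OF oddp(1)[OF po]] od[OF po] by auto
    qed
    show "t_path s W p" if p: "p \<in> odd_paths \<P> - \<S>"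
    proof -
      have po: "p \<in> odd_paths \<P>" and "A p = ev_set p" using p by (auto simp: A_def)
      then show ?thesis
        unfolding t_path_def ev_set_def[symmetric] using W1[OF oddp(1)[OF po]] evn[OF po] by auto
    qed
  qed
  have "U = W" if U: "is_U_odd G s t P\<^sub>e \<P> \<S> U" for U
  proof -
    have key: "U1 \<inter> set p \<subseteq> U2" if U12: "is_U_odd G s t P\<^sub>e \<P> \<S> U1" "is_U_odd G s t P\<^sub>e \<P> \<S> U2"
      and p: "p \<in> \<P>" for U1 U2 p
    proof -
      have i: "U1 \<inter> set P\<^sub>e = U2 \<inter> set P\<^sub>e" "s \<in> U2" "t \<in> U2"
        using U12 Pe unfolding is_U_odd_def internal_path_def ev_set_def[symmetric] by blast+
      consider "p = P\<^sub>e" | "p \<in> \<S>" | "p \<in> odd_paths \<P> - \<S>" using p P by blast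
      then show ?thesis
      proof cases
        case 1
        then show ?thesis using i by blast
      next
        case 2
        then have "(U1 \<inter> set p) - {t} = (U2 \<inter> set p) - {t}"
          using U12 by (simp add: is_U_odd_def s_path_def)
        then show ?thesis using i by blast
      next
        case 3
        then have "(U1 \<inter> set p) - {s} = (U2 \<inter> set p) - {s}"
          using U12 by (simp add: is_U_odd_def t_path_def)
        then show ?thesis using i by blast
      qed
    qed
    have "U \<subseteq> verts G" "W \<subseteq> verts G" using U exi by (auto simp: is_U_odd_def)
    then show ?thesis using key[OF U exi] key[OF exi U] unfolding V by blast
  qed
  with exi show ?thesis by blast
qed

end

theory Submission
  imports Defs
begin

text \<open>
  Every member of the family contains, on each path, either all inner vertices at odd positions
  (counted from \<open>t\<close>) or all at even positions, together with one or both of \<open>s\<close>, \<open>t\<close>.  A matching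
  argument on the paths shows that their common cardinality is the vertex cover number.

  An attack is answered by moving all guards inside a path one step in the same direction, which
  flips the parity of that path.  From \<open>U\<^sub>s\<close> or \<open>U\<^sub>t\<close> one shifts the even path and one odd path; from
  \<open>U\<^sub>\<S>\<close> an attack on an odd path is answered by exchanging an \<open>s\<close>-path with a \<open>t\<close>-path, and an
  attack on the even path by moving to \<open>U\<^sub>s\<close> or \<open>U\<^sub>t\<close>.  In each case the guards either rotate along a
  cycle formed by two paths or move along a matching.  As all members have the same size, it
  suffices that the move covers the target set: injectivity is then automatic.
\<close>

section \<open>Defenses by counting, and matchings on a path\<close>

text \<open>The image has at most \<open>card U = card W\<close> elements, so an image containing
  \<open>W\<close> is \<open>W\<close>, and a map of the finite set \<open>U\<close> onto a set of
  size \<open>card U\<close> is injective.\<close>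

lemma defense_onto:
  assumes "finite U" "card W = card U" "W \<subseteq> \<phi> ` U"
    and "\<And>u. u \<in> U \<Longrightarrow> \<phi> u \<in> closed_nbhd G u" "v \<in> U" "\<phi> v = w"
  shows "defense G U v w \<phi>" "\<phi> ` U = W"
proof -
  have "card (\<phi> ` U) \<le> card W" using assms by (simp add: card_image_le)
  then show eq: "\<phi> ` U = W" using assms by (metis card_seteq finite_imageI)
  have "inj_on \<phi> U" using assms eq by (intro eq_card_imp_inj_on) auto
  then show "defense G U v w \<phi>" using assms by (auto simp: defense_def)
qed

lemma defense_commute: "defense G U v w \<phi> \<longleftrightarrow> defense G U w v \<phi>"
  by (auto simp: defense_def)

text \<open>The edges between positions \<open>a + 2 * j\<close> and \<open>a + 2 * j + 1\<close>
  for \<open>j < n\<close> form a matching, and each of them needs its own element of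
  \<open>U\<close>.\<close>

lemma card_cover_path_ge:
  assumes "distinct p" "\<And>i. Suc i < length p \<Longrightarrow> {p ! i, p ! Suc i} \<inter> U \<noteq> {}"
    and "a + 2 * n \<le> length p"
  shows "n \<le> card (U \<inter> (!) p ` {a..<a + 2 * n})"
  using assms(3)
proof (induction n)
  case (Suc n)
  \<comment> \<open>An end of the last matching edge that lies in \<open>U\<close>; by distinctness
    of \<open>p\<close> it is not among the vertices counted before.\<close>
  define x where "x = (if p ! (a + 2 * n) \<in> U then p ! (a + 2 * n) else p ! Suc (a + 2 * n))"
  define D where "D = U \<inter> (!) p ` {a..<a + 2 * n}"
  have "x \<in> U" using assms(2)[of "a + 2 * n"] Suc.prems by (auto simp: x_def)
  moreover have "x \<in> (!) p ` {a..<a + 2 * Suc n}" by (auto simp: x_def)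
  ultimately have sub: "insert x D \<subseteq> U \<inter> (!) p ` {a..<a + 2 * Suc n}" by (auto simp: D_def)
  have "x \<notin> D" using Suc.prems assms(1) by (auto simp: x_def D_def nth_eq_iff_index_eq split: if_splits)
  then have "Suc (card D) = card (insert x D)" by (simp add: D_def)
  also have "\<dots> \<le> card (U \<inter> (!) p ` {a..<a + 2 * Suc n})" using sub by (intro card_mono) auto
  finally show ?case using Suc by (simp add: D_def)
qed simp

lemma card_odd_between: "card {i. 0 < i \<and> i < n \<and> odd i} = n div 2"
proof -
  have "{i. 0 < i \<and> i < n \<and> odd i} = (\<lambda>j. 2 * j + 1) ` {..<n div 2}"
    by (auto elim!: oddE simp: image_iff)
  then show ?thesis by (simp add: card_image inj_on_def)
qed

lemma card_even_between: "card {i. 0 < i \<and> i < n \<and> even i} = (n - 1) div 2"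
proof -
  have "{i. 0 < i \<and> i < n \<and> even i} = (\<lambda>j. 2 * j + 2) ` {..<(n - 1) div 2}"
  proof (intro set_eqI iffI)
    fix i assume "i \<in> {i. 0 < i \<and> i < n \<and> even i}"
    then have "i = 2 * (i div 2 - 1) + 2" "i div 2 - 1 < (n - 1) div 2" by auto
    then show "i \<in> (\<lambda>j. 2 * j + 2) ` {..<(n - 1) div 2}" by blast
  qed auto
  then show ?thesis by (simp add: card_image inj_on_def)
qed

section \<open>Structure of a melon graph with one even path\<close>

locale single_even_melon =
  fixes k :: nat and G :: "'a ugraph" and s t :: 'a and \<P> :: "'a list set" and P\<^sub>e :: "'a list"
  assumes k3: "k \<ge> 3" and mel: "melon_graph k G s t \<P>" and ev: "even_paths \<P> = {P\<^sub>e}"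
begin

abbreviation len :: "'a list \<Rightarrow> nat" where "len \<equiv> path_length"

abbreviation Odd :: "'a list set" where "Odd \<equiv> odd_paths \<P>"

lemma s_neq_t: "s \<noteq> t" "t \<noteq> s"
  using mel by (auto simp: melon_graph_def)

lemma path_facts:
  assumes "p \<in> \<P>"
  shows "p ! 0 = t" "p ! len p = s" "distinct p" "length p = Suc (len p)" "0 < len p"
  using assms mel
  by (auto simp: melon_graph_def is_path_def path_length_def hd_conv_nth last_conv_nth)

lemma Pe_facts: "P\<^sub>e \<in> \<P>" "even (len P\<^sub>e)" "P\<^sub>e \<notin> Odd" "len P\<^sub>e = 2 * half P\<^sub>e" "1 < len P\<^sub>e"
proof -
  show *: "P\<^sub>e \<in> \<P>" "even (len P\<^sub>e)" "P\<^sub>e \<notin> Odd"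
    using ev by (auto simp: even_paths_def odd_paths_def)
  then show "len P\<^sub>e = 2 * half P\<^sub>e" by (auto simp: half_def)
  have "len P\<^sub>e \<noteq> 1" using * by auto
  then show "1 < len P\<^sub>e" using path_facts(5)[OF *(1)] by linarith
qed

lemma Odd_facts:
  assumes "p \<in> Odd"
  shows "p \<in> \<P>" "odd (len p)" "len p = 2 * half p + 1" "p \<noteq> P\<^sub>e"
proof -
  show "p \<in> \<P>" and odd: "odd (len p)" using assms by (simp_all add: odd_paths_def)
  then show "len p = 2 * half p + 1" by (simp add: half_def)
  show "p \<noteq> P\<^sub>e" using odd Pe_facts(2) by blast
qed

lemma paths_eq: "\<P> = insert P\<^sub>e Odd"
  using ev by (auto simp: even_paths_def odd_paths_def)

lemma finite_paths: "finite \<P>" "finite Odd"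
  using mel by (auto simp: melon_graph_def odd_paths_def)

lemma card_Odd: "2 \<le> card Odd"
proof -
  have "card \<P> = k" using mel by (simp add: melon_graph_def)
  moreover have "card \<P> = Suc (card Odd)"
    using paths_eq Pe_facts(3) finite_paths(2) by (metis card_insert_disjoint)
  ultimately show ?thesis using k3 by simp
qed

lemma ex_Odd: obtains p where "p \<in> Odd"
  using card_Odd by fastforce

text \<open>Makes \<open>{q}\<close> and \<open>Odd - {q}\<close> nonempty proper subsets of
  \<open>Odd\<close> for \<open>q \<in> Odd\<close>; the answers from the covers with a single end
  lead to these.\<close>

lemma Odd_neq_singleton: "Odd \<noteq> {p}"
proof
  assume "Odd = {p}"
  then have "card Odd = card {p}" by (rule arg_cong)
  then show False using card_Odd by simp
qed

lemma verts_eq: "verts G = (\<Union>p \<in> \<P>. set p)"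
  using mel by (simp add: melon_graph_def)

lemma edge_iff: "e \<in> edges G \<longleftrightarrow> (\<exists>p \<in> \<P>. \<exists>i < len p. e = {p ! i, p ! Suc i})"
  using mel path_facts(4) by (fastforce simp: melon_graph_def path_edges_def)

lemma step_in_nbhd:
  assumes "p \<in> \<P>" "i < len p"
  shows "p ! Suc i \<in> closed_nbhd G (p ! i)" "p ! i \<in> closed_nbhd G (p ! Suc i)"
  using assms by (auto simp: closed_nbhd_def edge_iff insert_commute)

definition inner :: "'a list \<Rightarrow> 'a set" where
  "inner p = (!) p ` {0<..<len p}"

lemma nth_inner_neq:
  assumes "p \<in> \<P>" "0 < i" "i < len p"
  shows "p ! i \<noteq> s" "p ! i \<noteq> t"
  using path_facts[OF assms(1)] assms
  by (metis nth_eq_iff_index_eq less_SucI lessI less_irrefl,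
      metis nth_eq_iff_index_eq less_SucI zero_less_Suc less_irrefl)

lemma inner_eq: "p \<in> \<P> \<Longrightarrow> inner p = set p - {s, t}"
proof (intro set_eqI iffI)
  fix x assume p: "p \<in> \<P>" and "x \<in> inner p"
  then show "x \<in> set p - {s, t}"
    using nth_inner_neq path_facts[OF p] by (auto simp: inner_def)
next
  fix x assume p: "p \<in> \<P>" and "x \<in> set p - {s, t}"
  then obtain i where i: "i \<le> len p" "x = p ! i" "x \<noteq> s" "x \<noteq> t"
    using path_facts[OF p] by (auto simp: in_set_conv_nth less_Suc_eq_le)
  then have "i \<noteq> 0" "i \<noteq> len p" using path_facts[OF p] by metis+
  then show "x \<in> inner p" using i by (auto simp: inner_def)
qed

lemma inner_disjoint:
  assumes "p \<in> \<P>" "q \<in> \<P>" "p \<noteq> q" shows "inner p \<inter> inner q = {}"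
  using assms mel by (simp add: inner_eq melon_graph_def)

text \<open>Inner parts of different paths are disjoint and each path is distinct, so an inner
  vertex has unique coordinates: its path and its index. Both \<open>cover\<close> and
  \<open>shift\<close> are written in these coordinates.\<close>

lemma nth_inner_eq_iff:
  assumes "p \<in> \<P>" "0 < i" "i < len p" "q \<in> \<P>" "0 < j" "j < len q"
  shows "p ! i = q ! j \<longleftrightarrow> p = q \<and> i = j"
proof
  assume eq: "p ! i = q ! j"
  moreover have "p ! i \<in> inner p" "q ! j \<in> inner q" using assms by (auto simp: inner_def)
  ultimately have "p ! i \<in> inner p \<inter> inner q" by simp
  then have "p = q" using inner_disjoint assms by blast
  then show "p = q \<and> i = j"
    using eq assms path_facts[of p] by (simp add: nth_eq_iff_index_eq)
qed simp

lemma verts_eq_inner: "verts G = {s, t} \<union> (\<Union>p \<in> \<P>. inner p)"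
proof -
  have "s \<in> set P\<^sub>e" "t \<in> set P\<^sub>e" using path_facts[OF Pe_facts(1)] nth_mem[of _ P\<^sub>e]
    by (metis lessI, metis zero_less_Suc)
  then show ?thesis using Pe_facts(1) by (auto simp: verts_eq inner_eq)
qed

text \<open>The ends and the inner parts of the paths partition the vertices. The even path gets its
  own summand because its share in the covers below depends on which ends they contain.\<close>

lemma card_decompose:
  assumes "U \<subseteq> verts G"
  shows "card U = card (U \<inter> {s, t}) + card (U \<inter> inner P\<^sub>e) + (\<Sum>p \<in> Odd. card (U \<inter> inner p))"
proof -
  have fin: "finite (inner p)" for p by (simp add: inner_def)
  have "U = (U \<inter> {s, t}) \<union> (\<Union>p \<in> \<P>. U \<inter> inner p)" using assms by (auto simp: verts_eq_inner)
  also have "card \<dots> = card (U \<inter> {s, t}) + card (\<Union>p \<in> \<P>. U \<inter> inner p)"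
    using finite_paths fin by (intro card_Un_disjoint) (auto simp: inner_eq)
  also have "card (\<Union>p \<in> \<P>. U \<inter> inner p) = (\<Sum>p \<in> \<P>. card (U \<inter> inner p))"
    using finite_paths fin inner_disjoint by (intro card_UN_disjoint) fastforce+
  also have "\<dots> = card (U \<inter> inner P\<^sub>e) + (\<Sum>p \<in> Odd. card (U \<inter> inner p))"
    using finite_paths Pe_facts(3) by (subst paths_eq) simp
  finally show ?thesis by simp
qed

section \<open>Lower bound for vertex covers\<close>

text \<open>The size of \<open>U_s\<close>: the end \<open>s\<close>, the odd inner positions of the
  even path, and \<open>half p\<close> inner vertices on each odd path.\<close>

definition cover_number :: nat where
  "cover_number = 1 + half P\<^sub>e + (\<Sum>p \<in> Odd. half p)"

text \<open>The inner vertices of an odd path have a perfect matching, which gives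
  \<open>half p\<close>. On the even path the matching has \<open>half P\<^sub>e - 1\<close> edges
  inside; if an end is missing from \<open>U\<close>, it can be extended by the edge at that end,
  which gains one.\<close>

lemma vertex_cover_card_ge:
  assumes U: "vertex_cover G U"
  shows "cover_number \<le> card U"
proof -
  have sub: "U \<subseteq> verts G" using U by (simp add: vertex_cover_def)
  have covered: "{p ! i, p ! Suc i} \<inter> U \<noteq> {}" if "p \<in> \<P>" "i < len p" for p i
    using U that edge_iff by (metis vertex_cover_def)
  \<comment> \<open>The matched positions may include an end of the path as long as that end is not
    in \<open>U\<close>: the element of \<open>U\<close> on its edge is then an inner
    vertex.\<close>
  have match: "n \<le> card (U \<inter> inner p)"
    if "p \<in> \<P>" "a + 2 * n \<le> Suc (len p)" "U \<inter> (!) p ` {a..<a + 2 * n} \<subseteq> inner p" for p a n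
  proof -
    have "n \<le> card (U \<inter> (!) p ` {a..<a + 2 * n})"
      using that path_facts[OF that(1)] covered[OF that(1)]
      by (intro card_cover_path_ge) auto
    also have "\<dots> \<le> card (U \<inter> inner p)"
      using that by (intro card_mono) (auto simp: inner_def)
    finally show ?thesis .
  qed
  have inn: "p ! i \<in> inner p" if "p \<in> \<P>" "i \<le> len p" "p ! i \<in> U" "i = 0 \<longrightarrow> t \<notin> U"
    "i = len p \<longrightarrow> s \<notin> U" for p i
    using that path_facts[OF that(1)] by (cases "i = 0"; cases "i = len p") (auto simp: inner_def)
  have odd: "half p \<le> card (U \<inter> inner p)" if "p \<in> Odd" for p
    using Odd_facts[OF that] by (intro match[of p 1]) (auto simp: inner_def)
  have sum: "(\<Sum>p \<in> Odd. half p) \<le> (\<Sum>p \<in> Odd. card (U \<inter> inner p))"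
    by (intro sum_mono odd)
  note L = Pe_facts
  consider "s \<in> U" "t \<in> U" | "s \<in> U" "t \<notin> U" | "s \<notin> U" "t \<in> U" | "s \<notin> U" "t \<notin> U" by blast
  then show ?thesis
  proof cases
    case 1
    have "half P\<^sub>e - 1 \<le> card (U \<inter> inner P\<^sub>e)"
      using L by (intro match[of P\<^sub>e 1]) (auto simp: inner_def)
    moreover have "U \<inter> {s, t} = {s, t}" using 1 by auto
    ultimately show ?thesis
      unfolding card_decompose[OF sub] cover_number_def using sum s_neq_t by simp
  next
    case 2
    have "half P\<^sub>e \<le> card (U \<inter> inner P\<^sub>e)"
      using L 2 by (intro match[of P\<^sub>e 0]) (auto intro!: inn)
    moreover have "U \<inter> {s, t} = {s}" using 2 by auto
    ultimately show ?thesis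
      unfolding card_decompose[OF sub] cover_number_def using sum by simp
  next
    case 3
    have "half P\<^sub>e \<le> card (U \<inter> inner P\<^sub>e)"
      using L 3 by (intro match[of P\<^sub>e 1]) (auto intro!: inn)
    moreover have "U \<inter> {s, t} = {t}" using 3 by auto
    ultimately show ?thesis
      unfolding card_decompose[OF sub] cover_number_def using sum by simp
  next
    case 4
    have "half P\<^sub>e \<le> card (U \<inter> inner P\<^sub>e)"
      using L 4 by (intro match[of P\<^sub>e 0]) (auto intro!: inn)
    \<comment> \<open>With both ends missing, an odd path is perfectly matched including its ends.
      The surplus on the odd paths pays for the summand 1 of \<open>cover_number\<close>.\<close>
    moreover have "Suc (half p) \<le> card (U \<inter> inner p)" if "p \<in> Odd" for p
      using Odd_facts[OF that] 4 by (intro match[of p 0]) (auto intro!: inn)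
    then have "(\<Sum>p \<in> Odd. half p) < (\<Sum>p \<in> Odd. card (U \<inter> inner p))"
      using finite_paths card_Odd by (intro sum_strict_mono) (auto simp: Suc_le_eq)
    ultimately show ?thesis
      unfolding card_decompose[OF sub] cover_number_def by simp
  qed
qed

section \<open>Covers given by a set of ends and a parity for each path\<close>

text \<open>Common form of all sets in the theorem: \<open>U_s\<close> is
  \<open>cover {s} \<P>\<close>, \<open>U_t\<close> is \<open>cover {t} {P\<^sub>e}\<close>, and the
  set belonging to \<open>\<S>\<close> is \<open>cover {s, t} \<S>\<close>. Flipping the parity of a
  path only changes its membership in \<open>M\<close>.\<close>

definition cover :: "'a set \<Rightarrow> 'a list set \<Rightarrow> 'a set" where
  "cover X M = X \<union> {p ! i | p i. p \<in> \<P> \<and> 0 < i \<and> i < len p \<and> (odd i \<longleftrightarrow> p \<in> M)}"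

lemma nth_in_cover_iff:
  assumes "p \<in> \<P>" "0 < i" "i < len p" "X \<subseteq> {s, t}"
  shows "p ! i \<in> cover X M \<longleftrightarrow> (odd i \<longleftrightarrow> p \<in> M)"
proof -
  have "p ! i \<notin> X" using assms nth_inner_neq by blast
  then have "p ! i \<in> cover X M \<longleftrightarrow>
      (\<exists>q j. p ! i = q ! j \<and> q \<in> \<P> \<and> 0 < j \<and> j < len q \<and> (odd j \<longleftrightarrow> q \<in> M))"
    by (simp add: cover_def)
  also have "\<dots> \<longleftrightarrow> (odd i \<longleftrightarrow> p \<in> M)"
    using assms(1-3) nth_inner_eq_iff[OF assms(1-3)] by metis
  finally show ?thesis .
qed

lemma end_in_cover_iff: "s \<in> cover X M \<longleftrightarrow> s \<in> X" "t \<in> cover X M \<longleftrightarrow> t \<in> X"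
  unfolding cover_def using nth_inner_neq by blast+

lemma cover_subset: "X \<subseteq> {s, t} \<Longrightarrow> cover X M \<subseteq> verts G"
  unfolding verts_eq_inner cover_def inner_def by fastforce

lemma finite_cover: "X \<subseteq> {s, t} \<Longrightarrow> finite (cover X M)"
  using finite_subset[OF cover_subset] finite_paths by (simp add: verts_eq)

lemma card_cover_inner:
  assumes p: "p \<in> \<P>" and X: "X \<subseteq> {s, t}"
  shows "card (cover X M \<inter> inner p) = (if p \<in> M then len p div 2 else (len p - 1) div 2)"
proof -
  have "cover X M \<inter> inner p = (!) p ` {i. 0 < i \<and> i < len p \<and> (odd i \<longleftrightarrow> p \<in> M)}"
    using nth_in_cover_iff[OF p _ _ X] by (auto simp: inner_def)
  also have "card \<dots> = card {i. 0 < i \<and> i < len p \<and> (odd i \<longleftrightarrow> p \<in> M)}"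
    using path_facts[OF p] by (intro card_image) (auto simp: inj_on_def nth_eq_iff_index_eq)
  finally show ?thesis by (simp add: card_odd_between card_even_between)
qed

text \<open>The \<open>2 * half p\<close> inner positions of an odd path split evenly by parity. On
  the even path the odd ones outnumber the even ones by one, which compensates for a missing
  end.\<close>

lemma card_cover:
  assumes X: "X \<subseteq> {s, t}" "X \<noteq> {}" and "P\<^sub>e \<in> M \<longleftrightarrow> X \<noteq> {s, t}"
  shows "card (cover X M) = cover_number"
proof -
  have "cover X M \<inter> {s, t} = X" using X end_in_cover_iff[of X M] by auto
  moreover have "card (cover X M \<inter> inner p) = half p" if "p \<in> Odd" for p
    using Odd_facts[OF that] X by (simp add: card_cover_inner)
  moreover have "card (cover X M \<inter> inner P\<^sub>e) = (if X = {s, t} then half P\<^sub>e - 1 else half P\<^sub>e)"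
  proof -
    have "(2 * h - 1) div 2 = h - (1::nat)" for h by (cases h) auto
    then show ?thesis
      using assms(3) Pe_facts(4) by (simp add: card_cover_inner[OF Pe_facts(1) X(1)] del: One_nat_def)
  qed
  moreover have "card X = (if X = {s, t} then 2 else 1)"
  proof -
    have "X = {s} \<or> X = {t} \<or> X = {s, t}" using X by blast
    then show ?thesis using s_neq_t by auto
  qed
  moreover have "0 < half P\<^sub>e" using Pe_facts by simp
  ultimately show ?thesis
    unfolding card_decompose[OF cover_subset[OF X(1)]] cover_number_def by simp
qed

text \<open>Consecutive inner positions have opposite parity, so only the first and last edge of a
  path can fail. A missing end has to be replaced by its neighbour on each path, which is the other
  end if the path is a single edge.\<close>

lemma vertex_cover_cover:
  assumes X: "X \<subseteq> {s, t}"
    and "\<And>p. p \<in> \<P> \<Longrightarrow> t \<notin> X \<Longrightarrow> s \<in> X \<and> p \<in> M"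
    and "\<And>p. p \<in> \<P> \<Longrightarrow> s \<notin> X \<Longrightarrow> t \<in> X \<and> (odd (len p - 1) \<longleftrightarrow> p \<in> M)"
  shows "vertex_cover G (cover X M)"
  unfolding vertex_cover_def
proof (intro conjI ballI cover_subset X)
  fix e assume "e \<in> edges G"
  then obtain p i where p: "p \<in> \<P>" and i: "i < len p" and e: "e = {p ! i, p ! Suc i}"
    by (auto simp: edge_iff)
  note pf = path_facts[OF p]
  have "p ! i \<in> cover X M \<or> p ! Suc i \<in> cover X M"
  proof (cases "i = 0")
    case True
    then show ?thesis
      using pf assms(2)[OF p] nth_in_cover_iff[OF p, of 1 X M] X
      by (cases "len p = 1") (auto simp: end_in_cover_iff)
  next
    case i0: False
    show ?thesis
    proof (cases "Suc i = len p")
      case True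
      then have "i = len p - 1" by simp
      then show ?thesis
        using True i0 i pf assms(3)[OF p] nth_in_cover_iff[OF p, of i X M] X
        by (auto simp: end_in_cover_iff)
    next
      case False
      then show ?thesis
        using nth_in_cover_iff[OF p, of i X M] nth_in_cover_iff[OF p, of "Suc i" X M] X i i0 by auto
    qed
  qed
  then show "e \<inter> cover X M \<noteq> {}" using e by auto
qed

section \<open>Moving guards along paths\<close>

text \<open>Inner guards of paths in \<open>A\<close> step towards \<open>s\<close>, those of paths in \<open>B\<close> towards \<open>t\<close>.\<close>

definition shift :: "'a list set \<Rightarrow> 'a list set \<Rightarrow> 'a \<Rightarrow> 'a \<Rightarrow> 'a \<Rightarrow> 'a" where
  "shift A B a b x =
    (if x = s then a else if x = t then b
     else THE y. \<exists>p i. p \<in> \<P> \<and> 0 < i \<and> i < len p \<and> x = p ! i \<and>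
       y = p ! (if p \<in> A then Suc i else if p \<in> B then i - 1 else i))"

lemma shift_ends: "shift A B a b s = a" "shift A B a b t = b"
  using s_neq_t by (auto simp: shift_def)

text \<open>The description in \<open>shift\<close> has a unique solution because the coordinates of
  an inner vertex are unique.\<close>

lemma shift_nth:
  assumes "p \<in> \<P>" "0 < i" "i < len p"
  shows "shift A B a b (p ! i) = p ! (if p \<in> A then Suc i else if p \<in> B then i - 1 else i)"
proof -
  have "(\<exists>q j. q \<in> \<P> \<and> 0 < j \<and> j < len q \<and> p ! i = q ! j \<and>
       y = q ! (if q \<in> A then Suc j else if q \<in> B then j - 1 else j)) \<longleftrightarrow>
      y = p ! (if p \<in> A then Suc i else if p \<in> B then i - 1 else i)" for y
    using nth_inner_eq_iff[OF assms] assms by metis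
  then show ?thesis using nth_inner_neq[OF assms] by (simp add: shift_def)
qed

text \<open>At \<open>i = 0\<close> the moving guard stands on \<open>t\<close>, and its target is
  \<open>b\<close> whatever \<open>A\<close> is; hence the extra condition. In
  \<open>shift_down\<close> the same holds for \<open>s\<close> and \<open>a\<close>.\<close>

lemma shift_up:
  assumes "p \<in> \<P>" "i < len p" "p \<in> A" "i = 0 \<Longrightarrow> b = p ! 1"
  shows "shift A B a b (p ! i) = p ! Suc i"
  using assms path_facts(1)[OF assms(1)] shift_ends(2)[of A B a b] by (cases "i = 0") (auto simp: shift_nth)

lemma shift_down:
  assumes "p \<in> \<P>" "i < len p" "p \<in> B" "p \<notin> A" "Suc i = len p \<Longrightarrow> a = p ! (len p - 1)"
  shows "shift A B a b (p ! Suc i) = p ! i"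
proof (cases "Suc i = len p")
  case True
  then have "i = len p - 1" by simp
  then show ?thesis using True assms path_facts(2)[OF assms(1)] by (simp add: shift_ends)
next
  case False
  then show ?thesis using assms by (simp add: shift_nth)
qed

text \<open>By \<open>defense_onto\<close> it is enough that every vertex of the target cover is
  reached. Paths in \<open>A\<close> and \<open>B\<close> flip parity, so an inner target vertex on
  them is reached from the preceding position in the direction of motion. This position is an end
  only for index 1 on \<open>A\<close> and index \<open>len p - 1\<close> on \<open>B\<close>, which
  \<open>from_t\<close> and \<open>from_s\<close> treat. The conditions \<open>to_s\<close> and
  \<open>to_t\<close> name a guard that arrives at or stays on each end of the target.\<close>

lemma shift_defense:
  fixes A B M M' :: "'a list set" and X X' :: "'a set" and a b :: 'a
  defines "\<phi> \<equiv> shift A B a b"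
  assumes X: "X \<subseteq> {s, t}" and card: "card (cover X' M') = card (cover X M)"
    and AB: "A \<subseteq> \<P>" "B \<subseteq> \<P>" "A \<inter> B = {}"
    and M': "\<And>p. p \<in> \<P> \<Longrightarrow> p \<in> M' \<longleftrightarrow> (p \<in> M) \<noteq> (p \<in> A \<union> B)"
    and nbhd: "a \<in> closed_nbhd G s" "b \<in> closed_nbhd G t"
    and from_t: "\<And>p. p \<in> A \<Longrightarrow> 1 < len p \<Longrightarrow> p \<notin> M \<Longrightarrow> t \<in> X \<and> b = p ! 1"
    and from_s: "\<And>p. p \<in> B \<Longrightarrow> 1 < len p \<Longrightarrow> odd (len p) \<longleftrightarrow> p \<in> M \<Longrightarrow> s \<in> X \<and> a = p ! (len p - 1)"
    and X': "X' \<subseteq> {s, t}"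
    and to_s: "s \<in> X' \<Longrightarrow> s \<in> X \<and> a = s \<or> t \<in> X \<and> b = s \<or>
        (\<exists>p \<in> A. 1 < len p \<and> (even (len p) \<longleftrightarrow> p \<in> M))"
    and to_t: "t \<in> X' \<Longrightarrow> t \<in> X \<and> b = t \<or> s \<in> X \<and> a = t \<or> (\<exists>p \<in> B. 1 < len p \<and> p \<in> M)"
    and vw: "v \<in> cover X M" "\<phi> v = w"
  shows "defense G (cover X M) v w \<phi> \<and> \<phi> ` cover X M = cover X' M'"
proof -
  have \<phi>: "\<phi> s = a" "\<phi> t = b"
    "\<And>p i. p \<in> \<P> \<Longrightarrow> 0 < i \<Longrightarrow> i < len p \<Longrightarrow>
       \<phi> (p ! i) = p ! (if p \<in> A then Suc i else if p \<in> B then i - 1 else i)"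
    by (simp_all add: \<phi>_def shift_ends shift_nth)
  have img: "p ! j \<in> \<phi> ` cover X M"
    if "p \<in> \<P>" "0 < i" "i < len p" "odd i \<longleftrightarrow> p \<in> M"
      "j = (if p \<in> A then Suc i else if p \<in> B then i - 1 else i)" for p i j
  proof (rule image_eqI)
    show "p ! j = \<phi> (p ! i)" using that(5) \<phi>(3)[OF that(1-3)] by simp
    show "p ! i \<in> cover X M" using that(4) nth_in_cover_iff[OF that(1-3) X] by simp
  qed
  have img_s: "a \<in> \<phi> ` cover X M" if "s \<in> X"
    using that \<phi>(1) by (intro image_eqI[of _ _ s]) (simp_all add: end_in_cover_iff)
  have img_t: "b \<in> \<phi> ` cover X M" if "t \<in> X"
    using that \<phi>(2) by (intro image_eqI[of _ _ t]) (simp_all add: end_in_cover_iff)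
  have "cover X' M' \<subseteq> \<phi> ` cover X M"
  proof
    fix x assume x: "x \<in> cover X' M'"
    consider "x = s" "s \<in> X'" | "x = t" "t \<in> X'" |
      (inner) p i where "p \<in> \<P>" "0 < i" "i < len p" "odd i \<longleftrightarrow> p \<in> M'" "x = p ! i"
      using x X' by (auto simp: cover_def)
    then show "x \<in> \<phi> ` cover X M"
    proof cases
      case 1
      have "s \<in> \<phi> ` cover X M" if p: "p \<in> A" "1 < len p" "even (len p) \<longleftrightarrow> p \<in> M" for p
      proof -
        have "p ! len p \<in> \<phi> ` cover X M" using p AB by (intro img[of p "len p - 1"]) auto
        then show ?thesis using path_facts(2)[of p] p AB by auto
      qed
      then show ?thesis using to_s[OF 1(2)] img_s img_t 1 by metis
    next
      case 2
      have "t \<in> \<phi> ` cover X M" if p: "p \<in> B" "1 < len p" "p \<in> M" for p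
      proof -
        have "p ! 0 \<in> \<phi> ` cover X M" using p AB by (intro img[of p 1]) auto
        then show ?thesis using path_facts(1)[of p] p AB by auto
      qed
      then show ?thesis using to_t[OF 2(2)] img_s img_t 2 by metis
    next
      case inner
      note M'p = M'[OF inner(1)]
      consider (up) "p \<in> A" "p \<notin> B" | (down) "p \<in> B" "p \<notin> A" | (stay) "p \<notin> A" "p \<notin> B" using AB by blast
      then show ?thesis
      proof cases
        case up
        show ?thesis
        proof (cases "i = 1")
          case True
          then show ?thesis using from_t[of p] up inner M'p img_t by auto
        next
          case False
          then show ?thesis using img[of p "i - 1" i] up inner M'p by auto
        qed
      next
        case down
        show ?thesis
        proof (cases "Suc i = len p")
          case True
          then have "i = len p - 1" by simp
          \<comment> \<open>Index \<open>len p - 1\<close> belongs to the target exactly if its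
            parity fits \<open>M'\<close>, and \<open>M'\<close> is the opposite of \<open>M\<close>
            on \<open>B\<close>.\<close>
          moreover have "odd (len p) \<longleftrightarrow> p \<in> M" using True inner(4) M'p down by (metis even_Suc UnI2)
          ultimately show ?thesis using from_s[of p] down inner M'p img_s True by auto
        next
          case False
          then show ?thesis using img[of p "Suc i" i] down inner M'p by auto
        qed
      next
        case stay
        then show ?thesis using img[of p i i] inner M'p by auto
      qed
    qed
  qed
  moreover have "\<phi> u \<in> closed_nbhd G u" if u: "u \<in> cover X M" for u
  proof -
    consider "u = s" | "u = t" | p i where "p \<in> \<P>" "0 < i" "i < len p" "u = p ! i"
      using u X unfolding cover_def by blast
    then show ?thesis
    proof cases
      case (3 p i)
      then show ?thesis
        using step_in_nbhd[of p i] step_in_nbhd[of p "i - 1"] by (auto simp: \<phi> closed_nbhd_def)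
    qed (use nbhd \<phi> in auto)
  qed
  ultimately show ?thesis
    using defense_onto[OF finite_cover[OF X] card] vw by blast
qed

section \<open>The class and the answers to attacks\<close>

definition family :: "'a set set" where
  "family = {cover {s} \<P>, cover {t} {P\<^sub>e}} \<union>
     {cover {s, t} \<S> | \<S>. \<S> \<noteq> {} \<and> \<S> \<subset> Odd}"

lemma cover_st_in_family: "\<S> \<noteq> {} \<Longrightarrow> \<S> \<subset> Odd \<Longrightarrow> cover {s, t} \<S> \<in> family"
  unfolding family_def by blast

lemma end_nbhd:
  "s \<in> closed_nbhd G s" "t \<in> closed_nbhd G t"
  "p \<in> \<P> \<Longrightarrow> p ! (len p - 1) \<in> closed_nbhd G s" "p \<in> \<P> \<Longrightarrow> p ! 1 \<in> closed_nbhd G t"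
  using step_in_nbhd(1)[of p 0] step_in_nbhd(2)[of p "len p - 1"] path_facts[of p]
  by (auto simp: closed_nbhd_def)

text \<open>An odd path may be the single edge between \<open>s\<close> and \<open>t\<close>. It has
  no inner guard to enter an end, so the guard of the opposite end steps across instead.\<close>

lemma short_path:
  assumes "p \<in> \<P>"
  shows "1 < len p \<or> p ! (len p - 1) = t" "1 < len p \<or> p ! 1 = s"
proof -
  have "len p = 1 \<or> 1 < len p" using path_facts(5)[OF assms] by linarith
  then show "1 < len p \<or> p ! (len p - 1) = t" "1 < len p \<or> p ! 1 = s"
    using path_facts(1,2)[OF assms] by auto
qed

lemma in_paths_iff: "p \<in> \<P> \<longleftrightarrow> p = P\<^sub>e \<or> p \<in> Odd"
  using paths_eq by blast

lemma card_family:
  "card (cover {s} \<P>) = cover_number" "card (cover {t} {P\<^sub>e}) = cover_number"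
  "\<S> \<subseteq> Odd \<Longrightarrow> card (cover {s, t} \<S>) = cover_number"
proof -
  have "{s} \<noteq> {s, t}" "{t} \<noteq> {s, t}" using s_neq_t by auto
  then show "card (cover {s} \<P>) = cover_number" "card (cover {t} {P\<^sub>e}) = cover_number"
    using Pe_facts(1) by (simp_all add: card_cover)
  show "card (cover {s, t} \<S>) = cover_number" if "\<S> \<subseteq> Odd"
    using that Pe_facts(3) by (intro card_cover) auto
qed

text \<open>All paths are occupied at odd positions. Flipping the even path and one odd path
  \<open>q\<close> fills \<open>t\<close> and can be done in two directions, so that a guard can
  cross any edge either way as required. As \<open>t\<close> is vacant, the value \<open>t\<close>
  that \<open>shift\<close> assigns to it is a placeholder.\<close>

lemma defend_cover_s:
  assumes p: "p \<in> \<P>" and i: "i < len p"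
  shows "\<exists>\<phi>. defense G (cover {s} \<P>) (p ! i) (p ! Suc i) \<phi> \<and> \<phi> ` cover {s} \<P> \<in> family"
proof -
  let ?U = "cover {s} \<P>"
  have fam: "cover {s, t} (Odd - {q}) \<in> family" if "q \<in> Odd" for q
    using that Odd_neq_singleton[of q] by (intro cover_st_in_family) auto
  \<comment> \<open>Guards on the even path move towards \<open>s\<close>, the guard of
    \<open>s\<close> enters \<open>q\<close>, and those on \<open>q\<close> move towards
    \<open>t\<close>: a rotation of the cycle formed by both paths.\<close>
  have rotate: "defense G ?U v w (shift {P\<^sub>e} {q} (q ! (len q - 1)) t) \<and>
      shift {P\<^sub>e} {q} (q ! (len q - 1)) t ` ?U = cover {s, t} (Odd - {q})"
    if "q \<in> Odd" "v \<in> ?U" "shift {P\<^sub>e} {q} (q ! (len q - 1)) t v = w" for q v w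
    using that Odd_facts(1,2,4)[OF that(1)] Pe_facts(1-3,5) short_path(1)[of q]
    by (intro shift_defense) (auto simp: card_family end_nbhd in_paths_iff simp del: One_nat_def)
  \<comment> \<open>The guard of \<open>s\<close> stays, and the first inner guard of the even path
    moves to \<open>t\<close>.\<close>
  have swap: "defense G ?U v w (shift {q} {P\<^sub>e} s t) \<and>
      shift {q} {P\<^sub>e} s t ` ?U = cover {s, t} (Odd - {q})"
    if "q \<in> Odd" "v \<in> ?U" "shift {q} {P\<^sub>e} s t v = w" for q v w
    using that Odd_facts(1,2,4)[OF that(1)] Pe_facts(1-3,5)
    by (intro shift_defense) (auto simp: card_family end_nbhd in_paths_iff simp del: One_nat_def)
  obtain q where q: "q \<in> Odd" by (rule ex_Odd)
  have mem: "p ! j \<in> ?U" if "odd j" "j \<le> len p" for j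
    using that p path_facts(2)[OF p] nth_in_cover_iff[OF p, of j "{s}" \<P>] end_in_cover_iff(1)[of "{s}" \<P>]
    by (cases "j = len p") (auto intro: Nat.gr0I)
  \<comment> \<open>The guard stands on the odd one of the positions \<open>i\<close> and
    \<open>Suc i\<close>, so the parity of \<open>i\<close> fixes the direction of its step and with
    it the move.\<close>
  consider "p \<in> Odd" "odd i" | "p \<in> Odd" "even i" | "p = P\<^sub>e" "odd i" | "p = P\<^sub>e" "even i"
    using p paths_eq by blast
  then show ?thesis
  proof cases
    case 1
    have "shift {p} {P\<^sub>e} s t (p ! i) = p ! Suc i" using 1 p i by (intro shift_up) auto
    then show ?thesis using swap[of p] mem[of i] fam[of p] 1 i by fastforce
  next
    case 2
    have "shift {P\<^sub>e} {p} (p ! (len p - 1)) t (p ! Suc i) = p ! i"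
      using 2 p i Odd_facts[of p] by (intro shift_down) auto
    then show ?thesis
      using rotate[of p "p ! Suc i"] mem[of "Suc i"] fam[of p] 2 i by (metis defense_commute even_Suc Suc_leI)
  next
    case 3
    have "shift {P\<^sub>e} {q} (q ! (len q - 1)) t (p ! i) = p ! Suc i" using 3 p i by (intro shift_up) auto
    then show ?thesis using rotate[of q] mem[of i] fam[of q] q 3 i by fastforce
  next
    case 4
    have "Suc i \<noteq> len p" using 4 Pe_facts(2) by (metis even_Suc)
    then have "shift {q} {P\<^sub>e} s t (p ! Suc i) = p ! i"
      using 4 p i Odd_facts[OF q] by (intro shift_down) auto
    then show ?thesis
      using swap[of q "p ! Suc i"] mem[of "Suc i"] fam[of q] q 4 i by (metis defense_commute even_Suc Suc_leI)
  qed
qed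

text \<open>Mirror image of the answers from \<open>cover {s} \<P>\<close>: odd paths are now
  occupied at even positions, both moves fill \<open>s\<close>, and the placeholder is the value for
  \<open>s\<close>.\<close>

lemma defend_cover_t:
  assumes p: "p \<in> \<P>" and i: "i < len p"
  shows "\<exists>\<phi>. defense G (cover {t} {P\<^sub>e}) (p ! i) (p ! Suc i) \<phi> \<and> \<phi> ` cover {t} {P\<^sub>e} \<in> family"
proof -
  let ?U = "cover {t} {P\<^sub>e}"
  have fam: "cover {s, t} {q} \<in> family" if "q \<in> Odd" for q
    using that Odd_neq_singleton[of q] by (intro cover_st_in_family) auto
  have rotate: "defense G ?U v w (shift {q} {P\<^sub>e} s (q ! 1)) \<and>
      shift {q} {P\<^sub>e} s (q ! 1) ` ?U = cover {s, t} {q}"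
    if "q \<in> Odd" "v \<in> ?U" "shift {q} {P\<^sub>e} s (q ! 1) v = w" for q v w
    using that Odd_facts(1,2,4)[OF that(1)] Pe_facts(1-3,5) short_path(2)[of q]
    by (intro shift_defense) (auto simp: card_family end_nbhd in_paths_iff simp del: One_nat_def)
  have swap: "defense G ?U v w (shift {P\<^sub>e} {q} s t) \<and>
      shift {P\<^sub>e} {q} s t ` ?U = cover {s, t} {q}"
    if "q \<in> Odd" "v \<in> ?U" "shift {P\<^sub>e} {q} s t v = w" for q v w
    using that Odd_facts(1,2,4)[OF that(1)] Pe_facts(1-3,5)
    by (intro shift_defense) (auto simp: card_family end_nbhd in_paths_iff simp del: One_nat_def)
  obtain q where q: "q \<in> Odd" by (rule ex_Odd)
  have mem: "p ! j \<in> ?U" if "odd j \<longleftrightarrow> p = P\<^sub>e" "j < len p" for j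
    using that path_facts(1)[OF p] nth_in_cover_iff[OF p, of j "{t}" "{P\<^sub>e}"]
      end_in_cover_iff(2)[of "{t}" "{P\<^sub>e}"]
    by (cases "j = 0") auto
  consider "p \<in> Odd" "even i" | "p \<in> Odd" "odd i" | "p = P\<^sub>e" "odd i" | "p = P\<^sub>e" "even i"
    using p paths_eq by blast
  then show ?thesis
  proof cases
    case 1
    have "shift {p} {P\<^sub>e} s (p ! 1) (p ! i) = p ! Suc i" using 1 p i by (intro shift_up) auto
    then show ?thesis using rotate[of p "p ! i"] mem[of i] fam[of p] Odd_facts[of p] 1 i by metis
  next
    case 2
    have "Suc i \<noteq> len p" using 2 Odd_facts(2)[of p] by (metis even_Suc)
    then have lt: "Suc i < len p" using i by simp
    then have "shift {P\<^sub>e} {p} s t (p ! Suc i) = p ! i"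
      using 2 p i Odd_facts[of p] by (intro shift_down) auto
    then show ?thesis
      using swap[of p "p ! Suc i"] mem[of "Suc i"] fam[of p] Odd_facts[of p] 2 lt
      by (metis defense_commute even_Suc)
  next
    case 3
    have "shift {P\<^sub>e} {q} s t (p ! i) = p ! Suc i" using 3 p i by (intro shift_up) auto
    then show ?thesis using swap[of q] mem[of i] fam[of q] q 3 i by fastforce
  next
    case 4
    have "Suc i \<noteq> len p" using 4 Pe_facts(2) by (metis even_Suc)
    then have lt: "Suc i < len p" using i by simp
    then have "shift {q} {P\<^sub>e} s (q ! 1) (p ! Suc i) = p ! i"
      using 4 p i Odd_facts[OF q] by (intro shift_down) auto
    then show ?thesis
      using rotate[of q "p ! Suc i"] mem[of "Suc i"] fam[of q] q 4 lt by (metis defense_commute even_Suc)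
  qed
qed

text \<open>An attack on an odd path is met by exchanging some \<open>q \<in> \<S>\<close> with some
  \<open>r\<close> outside, so the new index set is again nonempty and proper. An attack on the even
  path draws a guard off an end and leads to a cover with one end.\<close>

lemma defend_cover_st:
  assumes p: "p \<in> \<P>" and i: "i < len p" and S: "\<S> \<noteq> {}" "\<S> \<subset> Odd"
  shows "\<exists>\<phi>. defense G (cover {s, t} \<S>) (p ! i) (p ! Suc i) \<phi> \<and> \<phi> ` cover {s, t} \<S> \<in> family"
proof -
  let ?U = "cover {s, t} \<S>"
  have fam: "cover {s, t} (insert r (\<S> - {q})) \<in> family" if "q \<in> \<S>" "r \<in> Odd - \<S>" for q r
    using that S by (intro cover_st_in_family) auto
  \<comment> \<open>All guards on the cycle formed by \<open>q\<close> and \<open>r\<close> advance,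
    and the guards on \<open>s\<close> and \<open>t\<close> take part.\<close>
  have rotate: "defense G ?U v w (shift {r} {q} (q ! (len q - 1)) (r ! 1)) \<and>
      shift {r} {q} (q ! (len q - 1)) (r ! 1) ` ?U = cover {s, t} (insert r (\<S> - {q}))"
    if "q \<in> \<S>" "r \<in> Odd - \<S>" "v \<in> ?U" "shift {r} {q} (q ! (len q - 1)) (r ! 1) v = w" for q r v w
  proof (intro shift_defense)
    have q: "q \<in> Odd" and r: "r \<in> Odd" using that S by auto
    note f = Odd_facts(1,2)[OF q] Odd_facts(1,2)[OF r]
    show "card (cover {s, t} (insert r (\<S> - {q}))) = card ?U"
      using that S by (subst (1 2) card_family) auto
    show "s \<in> {s, t} \<and> q ! (len q - 1) = s \<or> t \<in> {s, t} \<and> r ! 1 = s \<or>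
      (\<exists>p\<in>{r}. 1 < len p \<and> even (len p) = (p \<in> \<S>))"
      using f that short_path(2)[of r] by blast
    show "t \<in> {s, t} \<and> r ! 1 = t \<or> s \<in> {s, t} \<and> q ! (len q - 1) = t \<or>
      (\<exists>p\<in>{q}. 1 < len p \<and> p \<in> \<S>)"
      using f that short_path(1)[of q] by blast
    show "q ! (len q - 1) \<in> closed_nbhd G s" "r ! 1 \<in> closed_nbhd G t" using end_nbhd f by blast+
  qed (use that S Odd_facts(1) in auto)
  \<comment> \<open>Both ends keep their guards; only inner guards of \<open>q\<close> and
    \<open>r\<close> move.\<close>
  have swap: "defense G ?U v w (shift {q} {r} s t) \<and>
      shift {q} {r} s t ` ?U = cover {s, t} (insert r (\<S> - {q}))"
    if "q \<in> \<S>" "r \<in> Odd - \<S>" "v \<in> ?U" "shift {q} {r} s t v = w" for q r v w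
  proof (intro shift_defense)
    show "card (cover {s, t} (insert r (\<S> - {q}))) = card ?U"
      using that S by (subst (1 2) card_family) auto
  qed (use that S Odd_facts(1,2) end_nbhd in auto)
  \<comment> \<open>Once \<open>t\<close> is vacant, each path has to cover its first edge without
    it. All odd paths outside \<open>\<S>\<close> therefore flip together with the even
    path.\<close>
  have leave_t: "defense G ?U v w (shift {P\<^sub>e} (Odd - \<S>) s (P\<^sub>e ! 1)) \<and>
      shift {P\<^sub>e} (Odd - \<S>) s (P\<^sub>e ! 1) ` ?U = cover {s} \<P>"
    if "v \<in> ?U" "shift {P\<^sub>e} (Odd - \<S>) s (P\<^sub>e ! 1) v = w" for v w
  proof (intro shift_defense)
    show "card (cover {s} \<P>) = card ?U" using S by (simp add: card_family)
  qed (use that S Odd_facts(2) Pe_facts(1-3,5) s_neq_t in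
      \<open>auto simp: in_paths_iff end_nbhd(1,2) end_nbhd(3,4)[OF Pe_facts(1)] simp del: One_nat_def\<close>)
  \<comment> \<open>Symmetrically, vacating \<open>s\<close> flips all paths of \<open>\<S>\<close>
    and the even path.\<close>
  have leave_s: "defense G ?U v w (shift \<S> {P\<^sub>e} (P\<^sub>e ! (len P\<^sub>e - 1)) t) \<and>
      shift \<S> {P\<^sub>e} (P\<^sub>e ! (len P\<^sub>e - 1)) t ` ?U = cover {t} {P\<^sub>e}"
    if "v \<in> ?U" "shift \<S> {P\<^sub>e} (P\<^sub>e ! (len P\<^sub>e - 1)) t v = w" for v w
  proof (intro shift_defense)
    show "card (cover {t} {P\<^sub>e}) = card ?U" using S by (simp add: card_family)
  qed (use that S Odd_facts(2) Pe_facts(1-3,5) s_neq_t in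
      \<open>auto simp: in_paths_iff end_nbhd(1,2) end_nbhd(3,4)[OF Pe_facts(1)] simp del: One_nat_def\<close>)
  have fam': "cover {s} \<P> \<in> family" "cover {t} {P\<^sub>e} \<in> family" by (simp_all add: family_def)
  obtain q where q: "q \<in> \<S>" using S by blast
  obtain r where r: "r \<in> Odd - \<S>" using S by blast
  have mem: "p ! j \<in> ?U" if j: "odd j \<longleftrightarrow> p \<in> \<S>" "j \<le> len p" for j
  proof -
    consider "j = 0" | "j = len p" | "0 < j" "j < len p" using j(2) by linarith
    then show ?thesis
      using j(1) path_facts(1,2)[OF p] by cases (simp_all add: nth_in_cover_iff[OF p] end_in_cover_iff)
  qed
  have le: "Suc i \<le> len p" "i \<le> len p" using i by auto
  have Pe: "P\<^sub>e \<notin> \<S>" using S Pe_facts by auto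
  consider "p \<in> \<S>" "odd i" | "p \<in> \<S>" "even i" | "p \<in> Odd - \<S>" "even i" | "p \<in> Odd - \<S>" "odd i"
    | "p = P\<^sub>e" "even i" | "p = P\<^sub>e" "odd i"
    using p paths_eq by blast
  then show ?thesis
  proof cases
    case 1
    have "shift {p} {r} s t (p ! i) = p ! Suc i" using 1 p i by (intro shift_up) auto
    then show ?thesis using swap[OF 1(1) r mem[OF _ le(2)]] fam[OF 1(1) r] 1 by metis
  next
    case 2
    have "shift {r} {p} (p ! (len p - 1)) (r ! 1) (p ! Suc i) = p ! i"
      using 2 p i r by (intro shift_down) auto
    then show ?thesis
      using rotate[OF 2(1) r mem[OF _ le(1)]] fam[OF 2(1) r] 2 by (metis defense_commute even_Suc)
  next
    case 3
    have "shift {p} {q} (q ! (len q - 1)) (p ! 1) (p ! i) = p ! Suc i"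
      using 3 p i by (intro shift_up) auto
    then show ?thesis using rotate[OF q 3(1) mem[OF _ le(2)]] fam[OF q 3(1)] 3 by (metis DiffD2)
  next
    case 4
    have "Suc i \<noteq> len p" using 4 Odd_facts(2)[of p] by (metis DiffD1 even_Suc)
    then have "shift {q} {p} s t (p ! Suc i) = p ! i"
      using 4 p i q by (intro shift_down) auto
    then show ?thesis
      using swap[OF q 4(1) mem[OF _ le(1)]] fam[OF q 4(1)] 4 by (metis defense_commute even_Suc DiffD2)
  next
    case 5
    have "shift {P\<^sub>e} (Odd - \<S>) s (P\<^sub>e ! 1) (p ! i) = p ! Suc i"
      using 5 p i by (intro shift_up) auto
    then show ?thesis using leave_t[OF mem[OF _ le(2)]] fam' 5 Pe by metis
  next
    case 6
    have "shift \<S> {P\<^sub>e} (P\<^sub>e ! (len P\<^sub>e - 1)) t (p ! Suc i) = p ! i"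
      using 6 p i Pe by (intro shift_down) auto
    then show ?thesis
      using leave_s[OF mem[OF _ le(1)]] fam' 6 Pe by (metis defense_commute even_Suc)
  qed
qed

section \<open>The class is eternal and its size is optimal\<close>

lemma vertex_cover_family:
  assumes "U \<in> family" shows "vertex_cover G U" "card U = cover_number"
proof -
  \<comment> \<open>The position next to \<open>s\<close> is odd only on the even path, so without
    \<open>s\<close> the parity set has to be \<open>{P\<^sub>e}\<close>.\<close>
  have parity: "odd (len p - 1) \<longleftrightarrow> p \<in> {P\<^sub>e}" if "p \<in> \<P>" for p
  proof -
    have "odd (len p - 1) \<longleftrightarrow> even (len p)" using path_facts(5)[OF that] by (cases "len p") auto
    then show ?thesis using that Pe_facts(2,3) Odd_facts(2)[of p] in_paths_iff by blast
  qed
  have "vertex_cover G (cover {s} \<P>)" "vertex_cover G (cover {t} {P\<^sub>e})"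
    "vertex_cover G (cover {s, t} \<S>)" for \<S>
    by (rule vertex_cover_cover; use parity s_neq_t in blast)+
  then show "vertex_cover G U" using assms unfolding family_def by blast
  show "card U = cover_number" using assms card_family unfolding family_def by blast
qed

lemma evc_class_family: "evc_class G cover_number family"
  unfolding evc_class_def
proof (intro conjI ballI allI impI)
  show "family \<noteq> {}" by (simp add: family_def)
  fix U assume U: "U \<in> family"
  show "vertex_cover G U" "card U = cover_number" using vertex_cover_family[OF U] .
  fix v w assume "{v, w} \<in> edges G"
  then obtain p i where p: "p \<in> \<P>" "i < len p" and e: "{v, w} = {p ! i, p ! Suc i}"
    by (auto simp: edge_iff)
  have "\<exists>\<phi>. defense G U (p ! i) (p ! Suc i) \<phi> \<and> \<phi> ` U \<in> family"
  proof -
    consider "U = cover {s} \<P>" | "U = cover {t} {P\<^sub>e}" |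
      \<S> where "U = cover {s, t} \<S>" "\<S> \<noteq> {}" "\<S> \<subset> Odd"
      using U unfolding family_def by blast
    then show ?thesis
      using defend_cover_s[OF p] defend_cover_t[OF p] defend_cover_st[OF p] by cases simp_all
  qed
  then show "\<exists>\<phi>. defense G U v w \<phi> \<and> \<phi> ` U \<in> family"
    using e defense_commute by (metis doubleton_eq_iff)
qed

lemma vc_eq: "vc G = cover_number"
  unfolding vc_def
proof (rule Least_equality)
  have "cover {s} \<P> \<in> family" by (simp add: family_def)
  then show "\<exists>U. vertex_cover G U \<and> card U = cover_number" using vertex_cover_family by blast
qed (use vertex_cover_card_ge in blast)

text \<open>Any eternal class is nonempty and consists of vertex covers, so their lower bound
  applies to its size.\<close>

lemma evc_eq: "evc G = cover_number"
  unfolding evc_def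
proof (rule Least_equality)
  show "\<exists>\<U>. evc_class G cover_number \<U>" using evc_class_family by blast
  show "cover_number \<le> n" if "\<exists>\<U>. evc_class G n \<U>" for n
  proof -
    from that obtain U where "vertex_cover G U" "card U = n" unfolding evc_class_def by blast
    then show ?thesis using vertex_cover_card_ge[of U] by simp
  qed
qed

section \<open>Identification with the sets of the theorem\<close>

text \<open>The share of one path in \<open>cover\<close> without the ends. The index sets of the
  theorem include ends of matching parity, which are split off below.\<close>

definition inner_parity :: "'a list \<Rightarrow> bool \<Rightarrow> 'a set" where
  "inner_parity p b = (!) p ` {i. 0 < i \<and> i < len p \<and> (odd i \<longleftrightarrow> b)}"

lemma cover_eq_inner_parity: "cover X M = X \<union> (\<Union>p \<in> \<P>. inner_parity p (p \<in> M))"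
  by (auto simp: cover_def inner_parity_def)

lemma inner_parity_subset: "inner_parity p b \<subseteq> inner p"
  by (auto simp: inner_parity_def inner_def)

text \<open>On an odd path \<open>s\<close> has the odd index \<open>2 * half p + 1\<close> and
  \<open>t\<close> has index 0, so each parity class takes in exactly one end.\<close>

lemma nth_index_odd_path:
  assumes "p \<in> Odd"
  shows "{p ! (2 * i + 1) | i. i \<le> half p} = insert s (inner_parity p True)"
    and "{p ! (2 * i) | i. i \<le> half p} = insert t (inner_parity p False)"
proof -
  note L = Odd_facts(3)[OF assms] and pf = path_facts(1,2)[OF Odd_facts(1)[OF assms]]
  have "(\<lambda>i. 2 * i + 1) ` {..half p} = insert (len p) {i. 0 < i \<and> i < len p \<and> odd i}"
    using L by (auto elim!: oddE simp: image_iff)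
  then have "(!) p ` (\<lambda>i. 2 * i + 1) ` {..half p} = insert s (inner_parity p True)"
    using pf by (simp add: inner_parity_def)
  then show "{p ! (2 * i + 1) | i. i \<le> half p} = insert s (inner_parity p True)" by auto
  have "(\<lambda>i. 2 * i) ` {..half p} = insert 0 {i. 0 < i \<and> i < len p \<and> even i}"
    using L by (auto elim!: evenE simp: image_iff)
  then have "(!) p ` (\<lambda>i. 2 * i) ` {..half p} = insert t (inner_parity p False)"
    using pf by (simp add: inner_parity_def)
  then show "{p ! (2 * i) | i. i \<le> half p} = insert t (inner_parity p False)" by auto
qed

text \<open>On the even path both ends have even index.\<close>

lemma nth_index_even_path:
  shows "{P\<^sub>e ! (2 * j + 1) | j. j < half P\<^sub>e} = inner_parity P\<^sub>e True"
    and "{P\<^sub>e ! (2 * j) | j. j \<le> half P\<^sub>e} = insert s (insert t (inner_parity P\<^sub>e False))"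
proof -
  note L = Pe_facts(4) and pf = path_facts(1,2)[OF Pe_facts(1)]
  have "(\<lambda>i. 2 * i + 1) ` {..<half P\<^sub>e} = {i. 0 < i \<and> i < len P\<^sub>e \<and> odd i}"
    using L by (auto elim!: oddE simp: image_iff)
  then have "(!) P\<^sub>e ` (\<lambda>i. 2 * i + 1) ` {..<half P\<^sub>e} = inner_parity P\<^sub>e True"
    by (simp add: inner_parity_def)
  then show "{P\<^sub>e ! (2 * j + 1) | j. j < half P\<^sub>e} = inner_parity P\<^sub>e True" by auto
  have "(\<lambda>i. 2 * i) ` {..half P\<^sub>e} = insert (len P\<^sub>e) (insert 0 {i. 0 < i \<and> i < len P\<^sub>e \<and> even i})"
    using L by (auto elim!: evenE simp: image_iff)
  then have "(!) P\<^sub>e ` (\<lambda>i. 2 * i) ` {..half P\<^sub>e} = insert s (insert t (inner_parity P\<^sub>e False))"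
    using pf by (simp add: inner_parity_def)
  then show "{P\<^sub>e ! (2 * j) | j. j \<le> half P\<^sub>e} = insert s (insert t (inner_parity P\<^sub>e False))" by auto
qed

lemma UN_paths: "(\<Union>p \<in> \<P>. f p) = f P\<^sub>e \<union> (\<Union>p \<in> Odd. f p)"
  using arg_cong[OF paths_eq, of "\<lambda>A. \<Union>p \<in> A. f p"] by simp

lemma U_s_eq: "U_s s P\<^sub>e \<P> = cover {s} \<P>"
proof -
  have "U_s s P\<^sub>e \<P> = {s} \<union> inner_parity P\<^sub>e True \<union> (\<Union>p \<in> Odd. insert s (inner_parity p True))"
    unfolding U_s_def nth_index_even_path using nth_index_odd_path by auto
  also have "\<dots> = {s} \<union> (\<Union>p \<in> \<P>. inner_parity p True)" unfolding UN_paths by blast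
  finally show ?thesis by (simp add: cover_eq_inner_parity)
qed

lemma U_t_eq: "U_t t P\<^sub>e \<P> = cover {t} {P\<^sub>e}"
proof -
  have "U_t t P\<^sub>e \<P> = {t} \<union> inner_parity P\<^sub>e True \<union> (\<Union>p \<in> Odd. insert t (inner_parity p False))"
    unfolding U_t_def nth_index_even_path using nth_index_odd_path by auto
  also have "\<dots> = {t} \<union> (\<Union>p \<in> \<P>. inner_parity p (p \<in> {P\<^sub>e}))"
  proof -
    have "inner_parity p (p \<in> {P\<^sub>e}) = inner_parity p False" if "p \<in> Odd" for p
      using Odd_facts(4)[OF that] by simp
    then have "(\<Union>p \<in> Odd. inner_parity p (p \<in> {P\<^sub>e})) = (\<Union>p \<in> Odd. inner_parity p False)"
      by (rule SUP_cong[OF refl])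
    then show ?thesis unfolding UN_paths by auto
  qed
  finally show ?thesis by (simp add: cover_eq_inner_parity)
qed

lemma cover_Int_path:
  assumes "p \<in> \<P>"
  shows "cover {s, t} M \<inter> set p = insert s (insert t (inner_parity p (p \<in> M)))"
proof -
  have "s \<in> set p" "t \<in> set p"
    using path_facts[OF assms] nth_mem[of _ p] by (metis lessI, metis zero_less_Suc)
  then have "set p = {s, t} \<union> inner p" using inner_eq[OF assms] by blast
  moreover have "cover {s, t} M \<inter> inner p = inner_parity p (p \<in> M)"
    using nth_in_cover_iff[OF assms] by (auto simp: inner_def inner_parity_def)
  ultimately show ?thesis by (auto simp: end_in_cover_iff)
qed

text \<open>By uniqueness it suffices that the cover fits the description. Both ends belong to it
  through the internal even path; an s-path disregards \<open>t\<close> and a t-path disregards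
  \<open>s\<close>, which leaves the one end of the right parity.\<close>

lemma U_odd_eq:
  assumes "\<S> \<subseteq> Odd"
  shows "U_odd G s t P\<^sub>e \<P> \<S> = cover {s, t} \<S>"
  unfolding U_odd_def
proof (rule the1_equality[OF U_odd_unique_existence[OF mel ev assms]])
  have ends: "s \<notin> inner_parity p b" "t \<notin> inner_parity p b" if "p \<in> \<P>" for p b
    using inner_parity_subset[of p b] inner_eq[OF that] by auto
  have "s_path t (cover {s, t} \<S>) p" if "p \<in> \<S>" for p
  proof -
    have p: "p \<in> Odd" using that assms by blast
    then show ?thesis
      unfolding s_path_def nth_index_odd_path[OF p] cover_Int_path[OF Odd_facts(1)[OF p]]
      using that ends[OF Odd_facts(1)[OF p]] s_neq_t by auto
  qed
  moreover have "t_path s (cover {s, t} \<S>) p" if "p \<in> Odd - \<S>" for p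
  proof -
    have p: "p \<in> Odd" using that by blast
    then show ?thesis
      unfolding t_path_def nth_index_odd_path[OF p] cover_Int_path[OF Odd_facts(1)[OF p]]
      using that ends[OF Odd_facts(1)[OF p]] s_neq_t by auto
  qed
  moreover have "P\<^sub>e \<notin> \<S>" using assms Pe_facts by auto
  ultimately show "is_U_odd G s t P\<^sub>e \<P> \<S> (cover {s, t} \<S>)"
    using cover_subset[of "{s, t}" \<S>]
    by (simp add: is_U_odd_def internal_path_def nth_index_even_path cover_Int_path[OF Pe_facts(1)])
qed

lemma family_eq:
  "{U_s s P\<^sub>e \<P>, U_t t P\<^sub>e \<P>} \<union> {U_odd G s t P\<^sub>e \<P> \<S> | \<S>. \<S> \<noteq> {} \<and> \<S> \<subset> Odd} = family"
proof -
  have "{U_odd G s t P\<^sub>e \<P> \<S> | \<S>. \<S> \<noteq> {} \<and> \<S> \<subset> Odd} =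
      {cover {s, t} \<S> | \<S>. \<S> \<noteq> {} \<and> \<S> \<subset> Odd}"
    using U_odd_eq by (metis (no_types, opaque_lifting) psubset_imp_subset)
  then show ?thesis by (simp add: family_def U_s_eq U_t_eq)
qed

end

theorem theorem15:
  fixes k :: nat and G :: "'a ugraph" and s t :: 'a
    and \<P> :: "'a list set" and P\<^sub>e :: "'a list"
  assumes "k \<ge> 3"
    and "melon_graph k G s t \<P>"
    and "mixed \<P>"
    and "even_paths \<P> = {P\<^sub>e}"
  shows "evc G = vc G \<and>
    minimum_evc_class G
      ({U_s s P\<^sub>e \<P>, U_t t P\<^sub>e \<P>} \<union>
       {U_odd G s t P\<^sub>e \<P> \<S> | \<S>. \<S> \<noteq> {} \<and> \<S> \<subset> odd_paths \<P>})"
proof -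
  interpret single_even_melon k G s t \<P> P\<^sub>e using assms by unfold_locales
  show ?thesis
    unfolding minimum_evc_class_def family_eq evc_eq vc_eq using evc_class_family by blast
qed

end
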